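(* Let $\widehat\alpha_k=q^{3r^2-2r}-q^{3r^2-r}$ if $k=3r-1$, $\widehat\alpha_k=q^{3r^2+r}$ if $k=3r$, $\widehat\alpha_k=-q^{3r^2+2r}$ if $k=3r+1$. Then for every integer $p\ge1$, every positive integer $N$ and every primitive $N$th root of unity $q$, $$-\frac12+H_p^{(2)}(q)=q^p\left(\sum_{k=0}^{N-2}(-1)^kq^{-\binom{k+1}{2}+p(k^2+2k)}\widehat\alpha_k+\frac12q^{-p}\widehat\alpha_{N-1}\right).$$
   Context: $(a)_n=\prod_{k=1}^n(1-aq^{k-1})$, $\begin{bmatrix} n\\ k\end{bmatrix}=\frac{(q)_n}{(q)_{n-k}(q)_k}$. $H_p^{(2)}(q)=\sum_{n_p\ge\cdots\ge n_1\ge0}q^{n_p}(q^{n_p})_{n_p}\prod_{i=1}^{p-1}q^{n_i^2}\begin{bmatrix} n_{i+1}\\ n_i\end{bmatrix}$; at a root of unity only finitely many terms are nonzero. (In the paper $\widehat\alpha_k=\frac{1-q}{1-q^{k+1}}\alpha_k$ where $\alpha_k=\frac{1-q^{k+1}}{1-q}\widehat\alpha_k$ is part of a Bailey pair relative to $q^2$.) *)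

theory Defs
  imports "HOL-Analysis.Analysis"
begin

definition primitive_root_of_unity :: "nat \<Rightarrow> complex \<Rightarrow> bool" where
  "primitive_root_of_unity N q \<longleftrightarrow>
     N \<ge> 1 \<and> q ^ N = 1 \<and> (\<forall>m. 1 \<le> m \<and> m < N \<longrightarrow> q ^ m \<noteq> 1)"

definition qpoch :: "complex \<Rightarrow> complex \<Rightarrow> nat \<Rightarrow> complex" where
  "qpoch a q n = (\<Prod>k=1..n. 1 - a * q ^ (k - 1))"

text \<open>
  The abbreviation \<open>(q)\<^sub>n\<close> in the \<open>q\<close>-binomial coefficient stands for \<open>(q;q)\<^sub>n\<close>. The quotient is
  meaningful if the denominator is nonzero, in particular for \<open>k \<le> n < N\<close> when \<open>q\<close> is a primitive
  \<open>N\<close>th root of unity.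
\<close>

definition qbinom :: "complex \<Rightarrow> nat \<Rightarrow> nat \<Rightarrow> complex" where
  "qbinom q n k = qpoch q q n / (qpoch q q (n - k) * qpoch q q k)"

text \<open>
  The summation runs over the tuples \<open>n\<^sub>p \<ge> \<dots> \<ge> n\<^sub>1 \<ge> 0\<close>, represented as extensional functions on
  \<open>{1..p}\<close>. If \<open>q\<close> is a primitive \<open>N\<close>th root of unity and \<open>n\<^sub>p \<ge> N\<close>, one of the \<open>n\<^sub>p\<close> consecutive
  exponents \<open>n\<^sub>p, \<dots>, 2 n\<^sub>p - 1\<close> is a multiple of \<open>N\<close>, so the factor \<open>(q\<^bsup>n\<^sub>p\<^esup>)\<close> with index \<open>n\<^sub>p\<close> is zero
  and so is the whole summand, whatever value the quotients in it have. Only finitely many summands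
  (with \<open>n\<^sub>p < N\<close>) are then nonzero, and the infinite sum is their finite sum.
\<close>

definition H2 :: "nat \<Rightarrow> complex \<Rightarrow> complex" where
  "H2 p q = (\<Sum>\<^sub>\<infinity>n \<in> {n \<in> {1..p} \<rightarrow>\<^sub>E (UNIV :: nat set). mono_on {1..p} n}.
     q ^ n p * qpoch (q ^ n p) q (n p) *
     (\<Prod>i=1..<p. q ^ ((n i)\<^sup>2) * qbinom q (n (i + 1)) (n i)))"

text \<open>
  With \<open>r = (k + 1) div 3\<close> exactly one of \<open>k = 3 r - 1\<close>, \<open>k = 3 r\<close>, \<open>k = 3 r + 1\<close> holds, so the last
  branch is the case \<open>k = 3 r + 1\<close>.
\<close>

definition alpha_hat :: "complex \<Rightarrow> nat \<Rightarrow> complex" where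
  "alpha_hat q k =
     (let r = (int k + 1) div 3 in
      if int k = 3 * r - 1 then q powi (3 * r\<^sup>2 - 2 * r) - q powi (3 * r\<^sup>2 - r)
      else if int k = 3 * r then q powi (3 * r\<^sup>2 + r)
      else - (q powi (3 * r\<^sup>2 + 2 * r)))"

end

theory Submission
  imports Defs
begin

text \<open>
  Write \<open>[n, k]\<close> for the Gaussian binomial coefficient. Iterating Bailey's lemma with \<open>a = 1\<close> from the unit
  Bailey pair, the part of \<open>H\<^sub>p\<close> with \<open>n\<^sub>p = n\<close> becomes
  \<open>\<Sum>k\<le>n. w\<^sub>k (-1)\<^sup>k q\<^bsup>k(k-1)/2 + pk\<^sup>2\<^esup> V(n,k)\<close> with \<open>V(n,k) = q\<^sup>n (1 + q\<^sup>k) / (1 + q\<^sup>n) [2n, n - k]\<close>,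
  \<open>w\<^sub>0 = 1/2\<close> and \<open>w\<^sub>k = 1\<close> otherwise; the term \<open>n = 0\<close> of \<open>H\<^sub>p\<close> exceeds this by \<open>1/2\<close>. For every \<open>M\<close> the partial
  sum \<open>\<Sum>n<M. V(n,k)\<close> equals \<open>(1 - q\<^sup>M) [2M-1, M-k] + \<Sum>j. h\<^sub>k(j) [2M, M-k-j]\<close> with signed powers \<open>h\<^sub>k(j)\<close> of \<open>q\<close>
  depending on \<open>j\<close> modulo 3. If \<open>q\<close> is a primitive \<open>N\<close>th root of unity and \<open>M = N\<close>, only
  \<open>h\<^sub>k(N - k) = q\<^bsup>-k\<^sup>2\<^esup> \<alpha>\<^bsub>N-k-1\<^esub>\<close> survives (\<open>\<alpha>\<close> being \<open>alpha_hat\<close>), and replacing \<open>k\<close> by \<open>N - k\<close>, together with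
  \<open>q\<^bsup>N(N-1)/2\<^esup> = (-1)\<^bsup>N-1\<^esup>\<close>, gives the right-hand side.
\<close>

section \<open>Gaussian binomial coefficients\<close>

text \<open>
  Defined by the Pascal rule, so that they make sense (and are continuous in \<open>q\<close>) at roots of unity, where
  the quotient \<^const>\<open>qbinom\<close> may have a zero denominator. With an integer lower index
  both Pascal rules hold without side conditions on the index.
\<close>

primrec qbin :: "complex \<Rightarrow> nat \<Rightarrow> int \<Rightarrow> complex" where
  "qbin q 0 i = (if i = 0 then 1 else 0)"
| "qbin q (Suc n) i = q powi i * qbin q n i + qbin q n (i - 1)"

declare qbin.simps(2) [simp del]

lemma qbin_eq_0:
  "i < 0 \<or> i > int n \<Longrightarrow> qbin q n i = 0"
  by (induction n arbitrary: i) (auto simp: qbin.simps(2))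

lemma qbin_0 [simp]: "qbin q n 0 = 1"
  by (induction n) (auto simp: qbin.simps(2) qbin_eq_0)

text \<open>The other Pascal rule. In the induction the row is expanded once by each rule; the two
  orders agree because the mixed term carries the weight \<open>q ^ (n + 1)\<close> either
  way.\<close>

lemma qbin_Suc':
  assumes "q \<noteq> 0"
  shows "qbin q (Suc n) i = qbin q n i + q powi (int n + 1 - i) * qbin q n (i - 1)"
proof (induction n arbitrary: i)
  case 0
  then show ?case by (auto simp: qbin.simps(2))
next
  case (Suc n)
  have e: "q powi (int n + 2 - i) * q powi (i - 1) = q powi i * q powi (int n + 1 - i)"
    using assms by (simp add: power_int_add [symmetric])
  have "qbin q (Suc (Suc n)) i = q powi i * qbin q (Suc n) i + qbin q (Suc n) (i - 1)"
    by (rule qbin.simps(2))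
  also have "\<dots> = q powi i * (qbin q n i + q powi (int n + 1 - i) * qbin q n (i - 1))
      + (qbin q n (i - 1) + q powi (int n + 2 - i) * qbin q n (i - 2))"
    using Suc.IH [of i] Suc.IH [of "i - 1"] by (simp add: algebra_simps)
  also have "\<dots> = (q powi i * qbin q n i + qbin q n (i - 1))
      + q powi (int n + 2 - i) * (q powi (i - 1) * qbin q n (i - 1) + qbin q n (i - 2))"
    using e by (simp add: algebra_simps)
  also have "\<dots> = qbin q (Suc n) i + q powi (int (Suc n) + 1 - i) * qbin q (Suc n) (i - 1)"
    by (simp add: qbin.simps(2) algebra_simps)
  finally show ?case .
qed

text \<open>Equate the two Pascal rules. Being free of division, this relation between neighbours
  survives at roots of unity.\<close>

lemma qbin_ratio:
  assumes "q \<noteq> 0"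
  shows "(1 - q powi i) * qbin q n i = (1 - q powi (int n + 1 - i)) * qbin q n (i - 1)"
  using qbin_Suc' [OF assms, of n i] by (simp add: qbin.simps(2) algebra_simps)

section \<open>q-Pochhammer products and the quotient formula\<close>

lemma qpoch_0 [simp]: "qpoch a q 0 = 1"
  by (simp add: qpoch_def)

lemma qpoch_Suc: "qpoch a q (Suc n) = qpoch a q n * (1 - a * q ^ n)"
  by (simp add: qpoch_def)

lemma qpoch_self_Suc: "qpoch q q (Suc n) = qpoch q q n * (1 - q ^ Suc n)"
  by (simp add: qpoch_Suc)

lemma qpoch_power_mult: "qpoch q q m * qpoch (q ^ Suc m) q n = qpoch q q (m + n)"
  by (induction n) (simp_all add: qpoch_Suc power_add mult.assoc)

lemma qbin_mult_qpoch:
  assumes "q \<noteq> 0" "k \<le> n"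
  shows "qbin q n (int k) * qpoch q q k * qpoch q q (n - k) = qpoch q q n"
  using assms(2)
proof (induction k)
  case 0
  then show ?case by simp
next
  case (Suc k)
  then obtain d where d: "n - k = Suc d" and n: "n = k + Suc d"
    by (metis Suc_diff_Suc Suc_le_lessD add_diff_inverse_nat leD less_Suc_eq)
  have r: "(1 - q ^ Suc k) * qbin q n (int (Suc k)) = (1 - q ^ Suc d) * qbin q n (int k)"
    using qbin_ratio [OF assms(1), of "int (Suc k)" n] unfolding n
    by (simp add: power_int_def nat_add_distrib algebra_simps)
  have "qbin q n (int (Suc k)) * qpoch q q (Suc k) * qpoch q q (n - Suc k)
      = ((1 - q ^ Suc k) * qbin q n (int (Suc k))) * qpoch q q k * qpoch q q d"
    using n by (simp add: qpoch_self_Suc algebra_simps del: power_Suc)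
  also have "\<dots> = qbin q n (int k) * qpoch q q k * qpoch q q (n - k)"
    unfolding r d by (simp add: qpoch_self_Suc algebra_simps del: power_Suc)
  finally show ?case using Suc by simp
qed

section \<open>Coefficients near the middle of an even row\<close>

lemma qbin_central_ratio:
  assumes "q \<noteq> 0"
  shows "(q powi l - q ^ M) * qbin q (2 * M) (int M - l)
    = q powi l * (1 - q ^ M * q powi l * q) * qbin q (2 * M) (int M - l - 1)"
proof -
  have "q powi (int M - l) * q powi l = q ^ M"
    using assms by (simp add: power_int_add [symmetric])
  moreover have "q powi (int (2 * M) + 1 - (int M - l)) = q ^ M * q powi l * q"
    using assms by (simp add: power_int_add algebra_simps)
  ultimately show ?thesis
    using arg_cong [OF qbin_ratio [OF assms, of "int M - l" "2 * M"], of "\<lambda>z. q powi l * z"]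
    by (simp add: algebra_simps)
qed

lemma qbin_odd_central:
  assumes "q \<noteq> 0"
  shows "qbin q (Suc (2 * M)) (int M + 1 - l)
    = qbin q (2 * M) (int M - l + 1) + q ^ M * q powi l * qbin q (2 * M) (int M - l)"
  using qbin_Suc' [OF assms, of "2 * M" "int M + 1 - l"] assms
  by (simp add: power_int_add [symmetric] algebra_simps flip: power_int_of_nat)

text \<open>Two Pascal steps express row \<open>2 * M + 2\<close> by three neighbours in row
  \<open>2 * M\<close>; the rules are chosen so that the weights are polynomials in
  \<open>q\<close>, \<open>q ^ M\<close> and \<open>q powi l\<close>.\<close>

lemma qbin_central_Suc:
  assumes "q \<noteq> 0"
  shows "qbin q (2 * Suc M) (int (Suc M) - l)
    = qbin q (2 * M) (int M - l + 1) + (q ^ M * q powi l + q * (q ^ M)\<^sup>2) * qbin q (2 * M) (int M - l)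
      + q * q ^ M * q powi l * qbin q (2 * M) (int M - l - 1)"
proof -
  have "qbin q (2 * Suc M) (int (Suc M) - l) = qbin q (Suc (2 * M)) (int M + 1 - l)
     + q powi (int (2 * M) + 1 - l - int M + 2 * l) * qbin q (Suc (2 * M)) (int M - l)"
    using qbin_Suc' [OF assms, of "Suc (2 * M)" "int M + 1 - l"]
    by (simp add: algebra_simps)
  also have "qbin q (Suc (2 * M)) (int M - l)
     = q powi (int M - l) * qbin q (2 * M) (int M - l) + qbin q (2 * M) (int M - l - 1)"
    by (rule qbin.simps(2))
  also have "q powi (int (2 * M) + 1 - l - int M + 2 * l) = q * q ^ M * q powi l"
    using assms by (simp add: power_int_add algebra_simps)
  also have "q powi (int M - l) = q ^ M / q powi l"
    using assms by (simp add: power_int_diff)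
  finally show ?thesis
    using assms unfolding qbin_odd_central [OF assms]
    by (simp add: algebra_simps power2_eq_square)
qed

section \<open>Summation over the largest index\<close>

text \<open>
  Up to terms with a factor \<open>1 - q\<^sup>M\<close>, these are the coefficients of \<open>[2M, M - k - j]\<close> in the expansion of
  the partial sum \<open>\<Sum>n<M\<close> of \<open>q\<^sup>n (1 + q\<^sup>k) / (1 + q\<^sup>n) [2n, n - k]\<close>. The exponents were found by computing
  this expansion for small \<open>M\<close>.
\<close>

definition tail_coeff :: "complex \<Rightarrow> nat \<Rightarrow> nat \<Rightarrow> complex" where
  "tail_coeff q k j = (let s = j div 3 in
     if j mod 3 = 0 then q ^ (6 * s\<^sup>2 + s + (4 * s + 1) * k) - q ^ (6 * s\<^sup>2 - s + 4 * s * k)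
     else if j mod 3 = 1 then q ^ ((2 * s + 1) * (3 * s + 1) + (4 * s + 2) * k)
     else - (q ^ ((2 * s + 1) * (3 * s + 2) + (4 * s + 3) * k)))"

text \<open>
  One block of three consecutive indices \<open>j\<close> in the proof of \<open>tail_coeff_telescope\<close>. There \<open>m = q\<^sup>M\<close>, \<open>x = q\<^sup>l\<close>
  and \<open>ai = [2M, M - l - i]\<close> with \<open>l = k + 3s\<close>, while \<open>az\<close> has \<open>i = -1\<close>.
\<close>

lemma tail_block_identity:
  fixes q m x y a0 a1 a2 a3 az :: complex
  assumes R0: "(x - m) * a0 = x * (1 - m * x * q) * a1"
    and R1: "(q * x - m) * a1 = q * x * (1 - m * (q * x) * q) * a2"
    and R2: "(q\<^sup>2 * x - m) * a2 = q\<^sup>2 * x * (1 - m * (q\<^sup>2 * x) * q) * a3"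
  shows "(y - 1) * (az + (m * x + q * m\<^sup>2) * a0 + q * m * x * a1 - a0)
    + q * x\<^sup>2 * (a0 + (m * (q * x) + q * m\<^sup>2) * a1 + q * m * (q * x) * a2 - a1)
    - q * x\<^sup>2 * q * y * (a1 + (m * (q\<^sup>2 * x) + q * m\<^sup>2) * a2 + q * m * (q\<^sup>2 * x) * a3 - a2)
    = (q * m\<^sup>2 * a0 - (1 - y) * (az + (m * x + q * m\<^sup>2 - 1) * a0))
      - q ^ 5 * x ^ 4 * (q * m\<^sup>2 * a3 - (1 - q\<^sup>2 * y) * (a2 + (m * (q ^ 3 * x) + q * m\<^sup>2 - 1) * a3))"
    (is "?L = ?R")
proof -
  \<comment> \<open>The difference is a combination of the three hypotheses with explicit polynomial
    multipliers, so only a ring identity remains.\<close>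
  have "?R - ?L =
     - q * (m + x) * ((x - m) * a0 - x * (1 - m * x * q) * a1)
     + q ^ 3 * x ^ 3 * ((q\<^sup>2 * x - m) * a2 - q\<^sup>2 * x * (1 - m * (q\<^sup>2 * x) * q) * a3)
     + y * (q * x * ((q * x - m) * a1 - q * x * (1 - m * (q * x) * q) * a2)
       - q ^ 3 * x\<^sup>2 * (m + q\<^sup>2 * x) * ((q\<^sup>2 * x - m) * a2 - q\<^sup>2 * x * (1 - m * (q\<^sup>2 * x) * q) * a3))"
    by algebra
  then show ?thesis using R0 R1 R2 by simp
qed

lemma div_mod_3_simps:
  "(3 * s) mod 3 = (0::nat)" "(3 * s) div 3 = (s::nat)"
  "Suc (3 * s) mod 3 = 1" "Suc (3 * s) div 3 = s"
  "Suc (Suc (3 * s)) mod 3 = 2" "Suc (Suc (3 * s)) div 3 = s"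
  by presburger+

text \<open>Each block of three coefficients has the common factor \<open>P\<close>; the last claim
  gives the factor of the next block.\<close>

lemma tail_coeff_3:
  fixes q :: complex and k s :: nat
  defines "P \<equiv> q ^ (6 * s\<^sup>2 - s + 4 * s * k)" and "x \<equiv> q ^ (k + 3 * s)" and "y \<equiv> q ^ (2 * s + k)"
  shows "tail_coeff q k (3 * s) = P * (y - 1)"
    and "tail_coeff q k (Suc (3 * s)) = P * (q * x\<^sup>2)"
    and "tail_coeff q k (Suc (Suc (3 * s))) = - (P * (q * x\<^sup>2 * q * y))"
    and "q ^ (6 * (Suc s)\<^sup>2 - Suc s + 4 * Suc s * k) = P * (q ^ 5 * x ^ 4)"
proof -
  define e where "e = 6 * s\<^sup>2 - s"
  \<comment> \<open>The truncated subtraction is exact, since \<open>s\<close> is at most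
    \<open>6 * s\<^sup>2\<close>.\<close>
  have e: "6 * s\<^sup>2 = e + s"
    unfolding e_def by (cases s) (auto simp: power2_eq_square)
  have e': "6 * (Suc s)\<^sup>2 - Suc s = e + 12 * s + 5"
    using e by (simp add: power2_eq_square)
  have p: "P = q ^ (e + 4 * s * k)" by (simp add: P_def e_def)
  show "tail_coeff q k (3 * s) = P * (y - 1)"
    unfolding tail_coeff_def p y_def x_def Let_def div_mod_3_simps e
    by (simp add: algebra_simps flip: power_add power_mult power_Suc)
  have x2: "x\<^sup>2 = q ^ (2 * (k + 3 * s))"
    unfolding x_def by (metis power_mult mult.commute)
  have x4: "x ^ 4 = q ^ (4 * (k + 3 * s))"
    unfolding x_def by (metis power_mult mult.commute)
  have E1: "(2 * s + 1) * (3 * s + 1) + (4 * s + 2) * k = e + 4 * s * k + (1 + 2 * (k + 3 * s))"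
    using e by (simp add: power2_eq_square algebra_simps)
  have "tail_coeff q k (Suc (3 * s)) = q ^ (e + 4 * s * k + (1 + 2 * (k + 3 * s)))"
    unfolding tail_coeff_def Let_def div_mod_3_simps E1 by simp
  then show "tail_coeff q k (Suc (3 * s)) = P * (q * x\<^sup>2)"
    by (simp only: p x2 power_add power_one_right)
  have E2: "(2 * s + 1) * (3 * s + 2) + (4 * s + 3) * k
      = e + 4 * s * k + (1 + 2 * (k + 3 * s) + 1 + (2 * s + k))"
    using e by (simp add: power2_eq_square algebra_simps)
  have "tail_coeff q k (Suc (Suc (3 * s)))
      = - (q ^ (e + 4 * s * k + (1 + 2 * (k + 3 * s) + 1 + (2 * s + k))))"
    unfolding tail_coeff_def Let_def div_mod_3_simps E2 by simp
  then show "tail_coeff q k (Suc (Suc (3 * s))) = - (P * (q * x\<^sup>2 * q * y))"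
    by (simp only: p x2 y_def power_add power_one_right)
  have "6 * (Suc s)\<^sup>2 - Suc s + 4 * Suc s * k = e + 4 * s * k + (5 + 4 * (k + 3 * s))"
    unfolding e' by (simp add: algebra_simps)
  then show "q ^ (6 * (Suc s)\<^sup>2 - Suc s + 4 * Suc s * k) = P * (q ^ 5 * x ^ 4)"
    by (simp only: p x4 power_add)
qed

text \<open>An antidifference in \<open>s\<close>: block \<open>s\<close> of the increment from
  \<open>M\<close> to \<open>Suc M\<close> is the value at \<open>s\<close> minus the value at
  \<open>Suc s\<close>.\<close>

definition tail_certificate :: "complex \<Rightarrow> nat \<Rightarrow> nat \<Rightarrow> nat \<Rightarrow> complex" where
  "tail_certificate q M k s =
    q ^ (6 * s\<^sup>2 - s + 4 * s * k) *
      (q * (q ^ M)\<^sup>2 * qbin q (2 * M) (int M - int (k + 3 * s))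
       - (1 - q ^ (2 * s + k)) * (qbin q (2 * M) (int M - int (k + 3 * s) + 1)
          + (q ^ M * q ^ (k + 3 * s) + q * (q ^ M)\<^sup>2 - 1) * qbin q (2 * M) (int M - int (k + 3 * s))))"

lemma tail_coeff_telescope:
  assumes "q \<noteq> 0"
  shows "(\<Sum>j<3 * R. tail_coeff q k j * (qbin q (2 * Suc M) (int (Suc M) - int (k + j)) - qbin q (2 * M) (int M - int (k + j))))
    = tail_certificate q M k 0 - tail_certificate q M k R"
proof (induction R)
  case 0
  then show ?case by simp
next
  case (Suc s)
  define P where "P = q ^ (6 * s\<^sup>2 - s + 4 * s * k)"
  define x where "x = q ^ (k + 3 * s)"
  define y where "y = q ^ (2 * s + k)"
  define m where "m = q ^ M"
  define a where "a i = qbin q (2 * M) (int M - int (k + 3 * s) - i)" for i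
  have a: "qbin q (2 * M) (int M - int (k + 3 * s)) = a 0"
     "qbin q (2 * M) (int M - int (k + 3 * s) + 1) = a (-1)"
     "qbin q (2 * M) (int M - int (k + Suc (3 * s))) = a 1"
     "qbin q (2 * M) (int M - int (k + Suc (Suc (3 * s)))) = a 2"
     "qbin q (2 * M) (int M - int (k + 3 * Suc s)) = a 3"
     "qbin q (2 * M) (int M - int (k + 3 * Suc s) + 1) = a 2"
    unfolding a_def by (auto intro!: arg_cong [of _ _ "qbin q (2 * M)"])
  have R: "(q ^ nat i * x - m) * a i = q ^ nat i * x * (1 - m * (q ^ nat i * x) * q) * a (i + 1)"
    if "i \<ge> 0" for i
  proof -
    have "q powi (int (k + 3 * s) + i) = q ^ nat i * x"
      using assms that by (simp add: x_def power_int_add power_int_def nat_add_distrib power_add del: of_nat_add)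
    then show ?thesis
      using qbin_central_ratio [OF assms, of "int (k + 3 * s) + i" M]
      by (simp add: a_def m_def algebra_simps)
  qed
  have R0: "(x - m) * a 0 = x * (1 - m * x * q) * a 1" using R [of 0] by simp
  have R1: "(q * x - m) * a 1 = q * x * (1 - m * (q * x) * q) * a 2" using R [of 1] by simp
  have R2: "(q\<^sup>2 * x - m) * a 2 = q\<^sup>2 * x * (1 - m * (q\<^sup>2 * x) * q) * a 3"
    using R [of 2] by simp
  have B: "qbin q (2 * Suc M) (int (Suc M) - int (k + 3 * s + i)) =
      a (int i - 1) + (m * (q ^ i * x) + q * m\<^sup>2) * a (int i) + q * m * (q ^ i * x) * a (int i + 1)" for i
    unfolding qbin_central_Suc [OF assms] power_int_of_nat
    by (simp add: a_def m_def x_def power_add algebra_simps)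
  have b: "qbin q (2 * Suc M) (int (Suc M) - int (k + 3 * s)) = a (-1) + (m * x + q * m\<^sup>2) * a 0 + q * m * x * a 1"
     "qbin q (2 * Suc M) (int (Suc M) - int (k + Suc (3 * s))) = a 0 + (m * (q * x) + q * m\<^sup>2) * a 1 + q * m * (q * x) * a 2"
     "qbin q (2 * Suc M) (int (Suc M) - int (k + Suc (Suc (3 * s)))) = a 1 + (m * (q\<^sup>2 * x) + q * m\<^sup>2) * a 2 + q * m * (q\<^sup>2 * x) * a 3"
    using B [of 0] B [of 1] B [of 2] by (simp_all del: mult_Suc_right mult_Suc)
  note h = tail_coeff_3 [of q k s, folded P_def x_def y_def]
  have w: "tail_certificate q M k s = P * (q * m\<^sup>2 * a 0 - (1 - y) * (a (-1) + (m * x + q * m\<^sup>2 - 1) * a 0))"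
    unfolding tail_certificate_def a P_def m_def x_def y_def ..
  have w': "tail_certificate q M k (Suc s) = P * (q ^ 5 * x ^ 4 * (q * m\<^sup>2 * a 3 - (1 - q\<^sup>2 * y) * (a 2 + (m * (q ^ 3 * x) + q * m\<^sup>2 - 1) * a 3)))"
  proof -
    have e: "q ^ (k + 3 * Suc s) = q ^ 3 * x" "q ^ (2 * Suc s + k) = q\<^sup>2 * y"
      by (simp_all add: x_def y_def power_add power2_eq_square power3_eq_cube algebra_simps)
    have h4: "q ^ (6 * (Suc s)\<^sup>2 - Suc s + 4 * Suc s * k) = P * (q ^ 5 * x ^ 4)"
      unfolding P_def x_def by (rule tail_coeff_3(4))
    show ?thesis
      unfolding tail_certificate_def a e m_def [symmetric] by (subst h4) (rule mult.assoc)
  qed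
  have "(\<Sum>j<3 * Suc s. tail_coeff q k j * (qbin q (2 * Suc M) (int (Suc M) - int (k + j)) - qbin q (2 * M) (int M - int (k + j))))
     = tail_certificate q M k 0 - tail_certificate q M k s
       + P * ((y - 1) * (a (-1) + (m * x + q * m\<^sup>2) * a 0 + q * m * x * a 1 - a 0)
    + q * x\<^sup>2 * (a 0 + (m * (q * x) + q * m\<^sup>2) * a 1 + q * m * (q * x) * a 2 - a 1)
    - q * x\<^sup>2 * q * y * (a 1 + (m * (q\<^sup>2 * x) + q * m\<^sup>2) * a 2 + q * m * (q\<^sup>2 * x) * a 3 - a 2))"
  proof -
    have t: "3 * Suc s = Suc (Suc (Suc (3 * s)))" by simp
    show ?thesis
      unfolding t sum.lessThan_Suc Suc.IH a b h by (simp add: algebra_simps)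
  qed
  also have "\<dots> = tail_certificate q M k 0 - tail_certificate q M k (Suc s)"
    unfolding tail_block_identity [OF R0 R1 R2] w w' by (simp add: algebra_simps)
  finally show ?case .
qed

text \<open>
  This is \<open>q\<^sup>n (1 + q\<^sup>k) / (1 + q\<^sup>n) [2n, n - k]\<close>, written so that it stays meaningful if \<open>q\<^sup>n = -1\<close>. The
  truncated \<open>2 * n - 1\<close> at \<open>n = 0\<close> is harmless, because its factor \<open>1 - q\<^sup>n\<close> vanishes.
\<close>

definition central_term :: "complex \<Rightarrow> nat \<Rightarrow> nat \<Rightarrow> complex" where
  "central_term q n k = qbin q (2 * n) (int n - int k) - (1 - q ^ n) * qbin q (2 * n - 1) (int n - int k)"

text \<open>The right-hand side is \<open>central_term q M k\<close> minus the increment of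
  \<open>(1 - q ^ M) * qbin q (2 * M - 1) (int M - int k)\<close> from \<open>M\<close> to
  \<open>Suc M\<close>. This is what the induction in \<open>sum_central_term\<close> needs.\<close>

lemma tail_certificate_0:
  assumes "q \<noteq> 0"
  shows "tail_certificate q M k 0 = qbin q (2 * M) (int M - int k) - (1 - q ^ Suc M) * qbin q (Suc (2 * M)) (int (Suc M) - int k)"
proof -
  let ?x = "q ^ k" and ?m = "q ^ M"
  let ?a = "qbin q (2 * M) (int M - int k)" and ?z = "qbin q (2 * M) (int M - int k + 1)"
  \<comment> \<open>The central ratio at \<open>l = k - 1\<close>, multiplied by \<open>q\<close> to
    remove the exponent \<open>k - 1\<close>, which is negative for \<open>k = 0\<close>.\<close>
  have r: "(?x - q * ?m) * ?z = ?x * (1 - ?m * ?x) * ?a"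
  proof -
    have "q * q powi (int k - 1) = ?x"
      using assms by (simp add: power_int_diff)
    moreover have e: "int M - (int k - 1) = int M - int k + 1" "int M - int k + 1 - 1 = int M - int k"
      by simp_all
    have "(q powi (int k - 1) - ?m) * ?z
        = q powi (int k - 1) * (1 - ?m * q powi (int k - 1) * q) * ?a"
      using qbin_central_ratio [OF assms, of "int k - 1" M] unfolding e .
    moreover have "(q * c - q * m) * z = (q * c) * (1 - m * (q * c)) * a"
      if "(c - m) * z = c * (1 - m * c * q) * a" for c m z a :: complex
      using that by algebra
    ultimately show ?thesis by metis
  qed
  have o: "qbin q (Suc (2 * M)) (int (Suc M) - int k) = ?z + ?m * ?x * ?a"
    using qbin_odd_central [OF assms, of M "int k"] by (simp add: add.commute)
  have "tail_certificate q M k 0 = q * ?m\<^sup>2 * ?a - (1 - ?x) * (?z + (?m * ?x + q * ?m\<^sup>2 - 1) * ?a)"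
    by (simp add: tail_certificate_def)
  also have "\<dots> = ?a - (1 - q * ?m) * (?z + ?m * ?x * ?a)"
  proof -
    have "q * m\<^sup>2 * a - (1 - x) * (z + (m * x + q * m\<^sup>2 - 1) * a) = a - (1 - q * m) * (z + m * x * a)"
      if "(x - q * m) * z = x * (1 - m * x) * a" for m x a z
      using that by algebra
    then show ?thesis using r by blast
  qed
  finally show ?thesis by (simp only: o power_Suc)
qed

text \<open>Induction on \<open>M\<close> with \<open>R\<close> fixed. The bound on \<open>M\<close>
  makes the upper certificate vanish, because its lower indices are negative. For
  \<open>M = k\<close> only \<open>j = 0\<close> counts, and its coefficient
  \<open>q ^ k - 1\<close> cancels the first term.\<close>

lemma sum_central_term:
  assumes "q \<noteq> 0" and "k \<le> M" and "M \<le> 3 * R + k"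
  shows "(\<Sum>n=k..<M. central_term q n k) = (1 - q ^ M) * qbin q (2 * M - 1) (int M - int k)
    + (\<Sum>j<3 * R + 3. tail_coeff q k j * qbin q (2 * M) (int M - int (k + j)))"
  using assms(2,3)
proof (induction M rule: nat_induct_at_least)
  case base
  have "(\<Sum>j<3 * R + 3. tail_coeff q k j * qbin q (2 * k) (int k - int (k + j)))
    = (\<Sum>j<3 * R + 3. if j = 0 then tail_coeff q k 0 else 0)"
    by (intro sum.cong) (auto simp: qbin_eq_0)
  then show ?case
    by (simp add: tail_coeff_def)
next
  case (Suc M)
  have R: "3 * R + 3 = 3 * Suc R" by simp
  have w: "tail_certificate q M k (Suc R) = 0"
    using Suc.prems by (simp add: tail_certificate_def qbin_eq_0)
  show ?case
    using tail_coeff_telescope [OF assms(1), where k = k and R = "Suc R" and M = M] Suc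
    unfolding R w tail_certificate_0 [OF assms(1)]
    by (simp add: central_term_def right_diff_distrib sum_subtractf algebra_simps)
qed

section \<open>Evaluation at a primitive root of unity\<close>

lemma primitive_root_nonzero:
  assumes "primitive_root_of_unity N q" shows "q \<noteq> 0"
  using assms by (auto simp: primitive_root_of_unity_def power_0_left)

lemma primitive_root_powi_cong:
  assumes "primitive_root_of_unity N q" and "a = b + int N * c"
  shows "q powi a = q powi b"
proof -
  have "q powi (int N * c) = 1"
    using assms(1) by (simp add: power_int_mult primitive_root_of_unity_def)
  then show ?thesis
    using primitive_root_nonzero [OF assms(1)] by (simp add: assms(2) power_int_add)
qed

lemma choose_two_add: "(k + c) choose 2 = (k choose 2) + (c choose 2) + k * c"
proof -
  have S: "Suc n choose 2 = (n choose 2) + n" for n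
    by (simp add: numeral_2_eq_2)
  show ?thesis by (induction k) (simp_all add: S numeral_2_eq_2 algebra_simps)
qed

text \<open>For odd \<open>N\<close> the exponent is a multiple of \<open>N\<close>; for
  \<open>N = 2 * a\<close> primitivity forces \<open>q ^ a = - 1\<close>.\<close>

lemma primitive_root_power_choose_two:
  assumes "primitive_root_of_unity N q"
  shows "q ^ (N choose 2) = (- 1) ^ (N - 1)"
proof (cases "odd N")
  case True
  then obtain a where a: "N = 2 * a + 1" by (elim oddE)
  have "N choose 2 = N * a"
    using a by (simp add: choose_two)
  then have "q ^ (N choose 2) = (q ^ N) ^ a"
    by (simp only: power_mult)
  then show ?thesis
    using assms a by (simp only: primitive_root_of_unity_def) simp
next
  case False
  then obtain a where a: "N = 2 * a" by auto
  have "a \<ge> 1" using assms a by (cases a) (auto simp: primitive_root_of_unity_def)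
  then have "q ^ a \<noteq> 1" "(q ^ a)\<^sup>2 = 1"
    using assms a by (auto simp: primitive_root_of_unity_def mult.commute simp flip: power_mult)
  then have "q ^ a = - 1" by (simp add: power2_eq_1_iff)
  moreover have "N choose 2 = a * (N - 1)"
    using a by (simp add: choose_two)
  ultimately show ?thesis by (simp add: power_mult)
qed

text \<open>Climb from \<open>i = 1\<close> with \<open>qbin_ratio\<close>: there the right-hand
  factor is \<open>1 - q ^ (2 * N) = 0\<close>, and the left factors \<open>1 - q ^ i\<close> are
  nonzero below \<open>N\<close>.\<close>

lemma qbin_primitive_root:
  assumes "primitive_root_of_unity N q" and "0 < i" "i < N"
  shows "qbin q (2 * N) (int i) = 0"
  using assms(2,3)
proof (induction i)
  case (Suc i)
  have q: "q \<noteq> 0" "q ^ N = 1" "q ^ Suc i \<noteq> 1"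
    using assms(1) Suc.prems primitive_root_nonzero [OF assms(1)]
    by (auto simp: primitive_root_of_unity_def)
  have "(1 - q powi int (Suc i)) * qbin q (2 * N) (int (Suc i)) = 0"
  proof (cases "i = 0")
    case True
    have "q ^ (2 * N) = 1" using q(2) by (metis mult.commute power_mult power_one)
    then have "q powi (int (2 * N) + 1 - int (Suc i)) = 1"
      using True by (simp flip: power_int_of_nat)
    then show ?thesis unfolding qbin_ratio [OF q(1)] by simp
  next
    case False
    then show ?thesis unfolding qbin_ratio [OF q(1)] using Suc by simp
  qed
  then show ?case using q(3) by (simp del: power_Suc of_nat_Suc)
qed simp

lemma sum_central_term_primitive_root:
  assumes "primitive_root_of_unity N q" and "k < N"
  shows "(\<Sum>n=k..<N. central_term q n k) = tail_coeff q k (N - k)"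
proof -
  have q: "q \<noteq> 0" "q ^ N = 1"
    using assms(1) primitive_root_nonzero [OF assms(1)] by (simp_all add: primitive_root_of_unity_def)
  have "tail_coeff q k j * qbin q (2 * N) (int N - int (k + j)) = (if j = N - k then tail_coeff q k j else 0)" for j
  proof -
    \<comment> \<open>The lower index is 0, negative, \<open>N\<close>, or strictly between 0 and
      \<open>N\<close>. The middle coefficient, at index \<open>N\<close>, need not vanish, but then
      \<open>tail_coeff q 0 0 = 0\<close>.\<close>
    consider "j = N - k" | "j > N - k" | "k = 0" "j = 0" | "j < N - k" "k + j > 0" by linarith
    then show ?thesis
    proof cases
      case 4
      then have "int N - int (k + j) = int (N - (k + j))" by simp
      then show ?thesis using 4 qbin_primitive_root [OF assms(1), of "N - (k + j)"] by simp
    qed (use assms(2) in \<open>auto simp: qbin_eq_0 tail_coeff_def\<close>)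
  qed
  then show ?thesis
    using sum_central_term [OF q(1), of k N N] assms(2) q(2) by simp
qed

lemma alpha_hat_3:
  shows "alpha_hat q (3 * s + 2) = q powi (3 * (int s + 1)\<^sup>2 - 2 * (int s + 1)) - q powi (3 * (int s + 1)\<^sup>2 - (int s + 1))"
    and "alpha_hat q (3 * s) = q powi (3 * (int s)\<^sup>2 + int s)"
    and "alpha_hat q (3 * s + 1) = - (q powi (3 * (int s)\<^sup>2 + 2 * int s))"
proof -
  have "(int (3 * s + 2) + 1) div 3 = int s + 1" "(int (3 * s) + 1) div 3 = int s"
    "(int (3 * s + 1) + 1) div 3 = int s"
    by presburger+
  then show "alpha_hat q (3 * s + 2) = q powi (3 * (int s + 1)\<^sup>2 - 2 * (int s + 1)) - q powi (3 * (int s + 1)\<^sup>2 - (int s + 1))"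
    and "alpha_hat q (3 * s) = q powi (3 * (int s)\<^sup>2 + int s)"
    and "alpha_hat q (3 * s + 1) = - (q powi (3 * (int s)\<^sup>2 + 2 * int s))"
    unfolding alpha_hat_def Let_def by (simp_all add: add.commute)
qed

lemma tail_coeff_primitive_root:
  assumes "primitive_root_of_unity N q" and N: "N = k + Suc i"
  shows "tail_coeff q k (Suc i) = q powi (- (int k)\<^sup>2) * alpha_hat q i"
proof -
  have q: "q \<noteq> 0" using primitive_root_nonzero [OF assms(1)] .
  \<comment> \<open>Exponents only matter modulo \<open>N\<close>. In each use below,
    \<open>c\<close> is the cofactor left when the exponent difference is divided by
    \<open>N\<close>.\<close>
  have cong: "q ^ n = q powi (- (int k)\<^sup>2) * q powi b" if "int n + (int k)\<^sup>2 - b = int N * c" for n b c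
  proof -
    have "q powi (int n) = q powi (- (int k)\<^sup>2 + b)"
      by (rule primitive_root_powi_cong [OF assms(1), where c = c]) (use that in simp)
    then show ?thesis using q power_int_add [of q "- (int k)\<^sup>2" b] by simp
  qed
  consider s where "i = 3 * s + 2" | s where "i = 3 * s" | s where "i = 3 * s + 1"
    by (metis add.right_neutral div_mult_mod_eq mult.commute mod_less_divisor zero_less_numeral numeral_3_eq_3 less_Suc_eq less_Suc0 One_nat_def Suc_1)
  then show ?thesis
  proof cases
    case 1
    define t where "t = Suc s"
    have t: "Suc i = 3 * t" using 1 by (simp add: t_def)
    define e where "e = 6 * t\<^sup>2 - t"
    have e: "int e = 6 * (int t)\<^sup>2 - int t"
      unfolding e_def by (subst of_nat_diff) (auto simp: power2_eq_square)
    have "q ^ (6 * t\<^sup>2 + t + (4 * t + 1) * k) = q powi (- (int k)\<^sup>2) * q powi (3 * (int t)\<^sup>2 - 2 * int t)"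
      by (rule cong [where c = "int k + int t + 1"]) (simp add: N t power2_eq_square algebra_simps)
    moreover have "q ^ (e + 4 * t * k) = q powi (- (int k)\<^sup>2) * q powi (3 * (int t)\<^sup>2 - int t)"
      by (rule cong [where c = "int k + int t"]) (simp add: e N t power2_eq_square algebra_simps)
    ultimately show ?thesis
      unfolding t 1 alpha_hat_3 unfolding tail_coeff_def Let_def div_mod_3_simps
      by (simp add: e_def t_def add.commute right_diff_distrib)
  next
    case 2
    have "q ^ ((2 * s + 1) * (3 * s + 1) + (4 * s + 2) * k) = q powi (- (int k)\<^sup>2) * q powi (3 * (int s)\<^sup>2 + int s)"
      by (rule cong [where c = "int k + int s + 1"]) (simp add: N 2 power2_eq_square algebra_simps)
    then show ?thesis
      unfolding 2 alpha_hat_3 unfolding tail_coeff_def Let_def div_mod_3_simps by simp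
  next
    case 3
    have "q ^ ((2 * s + 1) * (3 * s + 2) + (4 * s + 3) * k) = q powi (- (int k)\<^sup>2) * q powi (3 * (int s)\<^sup>2 + 2 * int s)"
      by (rule cong [where c = "int k + int s + 1"]) (simp add: N 3 power2_eq_square algebra_simps)
    then show ?thesis
      unfolding 3 alpha_hat_3 unfolding tail_coeff_def Let_def add_Suc_right add_0_right One_nat_def div_mod_3_simps by simp
  qed
qed

text \<open>The Bailey coefficient without its factor \<open>1 + q ^ k\<close>, which goes into
  \<open>central_term\<close>. At \<open>k = 0\<close> that factor is 2 while the coefficient is 1,
  hence \<open>1 / 2\<close>.\<close>

definition outer_coeff :: "complex \<Rightarrow> nat \<Rightarrow> nat \<Rightarrow> complex" where
  "outer_coeff q p k = (if k = 0 then 1 / 2 else (- 1) ^ k * q ^ ((k choose 2) + p * k\<^sup>2))"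

text \<open>Modulo \<open>N\<close>, \<open>i + 1\<close> is \<open>- k\<close>. Splitting
  \<open>N choose 2\<close> by \<open>choose_two_add\<close> therefore turns
  \<open>(k choose 2) - k\<^sup>2\<close> into \<open>(N choose 2) - (i + 1 choose 2)\<close>, and
  \<open>p * k\<^sup>2\<close> into \<open>p * (i + 1)\<^sup>2\<close>.\<close>

lemma outer_coeff_primitive_root:
  assumes "primitive_root_of_unity N q" and N: "N = k + Suc i" and "k > 0"
  shows "outer_coeff q p k * tail_coeff q k (Suc i) =
    q ^ p * ((- 1) ^ i * q powi (- int ((i + 1) choose 2) + int p * (int i ^ 2 + 2 * int i)) * alpha_hat q i)"
proof -
  define e where "e = - int (Suc i choose 2) + int p * (int (Suc i))\<^sup>2"
  have q: "q \<noteq> 0" using primitive_root_nonzero [OF assms(1)] .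
  have "q powi (int ((k choose 2) + p * k\<^sup>2) - (int k)\<^sup>2) = q powi (e + int (N choose 2))"
    by (rule primitive_root_powi_cong [OF assms(1), where c = "int p * (int k - int (Suc i)) - int k"])
       (unfold e_def N choose_two_add, simp add: power2_eq_square algebra_simps)
  also have "\<dots> = (- 1) ^ (k + i) * q powi e"
    using primitive_root_power_choose_two [OF assms(1)] q N by (simp add: power_int_add)
  finally have 1: "q powi (int ((k choose 2) + p * k\<^sup>2) - (int k)\<^sup>2) = (- 1) ^ (k + i) * q powi e" .
  have 2: "q powi e = q ^ p * q powi (- int ((i + 1) choose 2) + int p * (int i ^ 2 + 2 * int i))"
  proof -
    have "e = int p + (- int ((i + 1) choose 2) + int p * (int i ^ 2 + 2 * int i))"
      by (simp add: e_def power2_eq_square algebra_simps)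
    then show ?thesis using q by (simp only: power_int_add power_int_of_nat simp_thms)
  qed
  have "outer_coeff q p k * tail_coeff q k (Suc i)
      = (- 1) ^ k * q powi (int ((k choose 2) + p * k\<^sup>2) - (int k)\<^sup>2) * alpha_hat q i"
    using assms(3) q unfolding tail_coeff_primitive_root [OF assms(1,2)]
    by (simp add: outer_coeff_def power_int_diff power_int_minus divide_inverse power_int_add flip: power_int_of_nat)
  then show ?thesis
    unfolding 1 2 by (simp add: power_add mult_ac flip: power_mult_distrib)
qed

text \<open>Sum over \<open>n\<close> first, then reverse by \<open>k = N - 1 - i\<close>. The index
  \<open>k = 0\<close> gives the halved last term.\<close>

lemma sum_central_term_eq_alpha_hat:
  assumes "primitive_root_of_unity N q" and "N \<ge> 1"
  shows "(\<Sum>n<N. \<Sum>k\<le>n. outer_coeff q p k * central_term q n k) =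
    q ^ p * ((\<Sum>k\<in>{0..<N - 1}. (- 1) ^ k
                 * q powi (- int ((k + 1) choose 2) + int p * (int k ^ 2 + 2 * int k))
                 * alpha_hat q k)
             + 1 / 2 * q powi (- int p) * alpha_hat q (N - 1))"
proof -
  have q: "q \<noteq> 0" using primitive_root_nonzero [OF assms(1)] .
  have "(\<Sum>n<N. \<Sum>k\<le>n. outer_coeff q p k * central_term q n k) = (\<Sum>k<N. \<Sum>n=k..<N. outer_coeff q p k * central_term q n k)"
    unfolding sum.Sigma [OF finite_lessThan ballI [OF finite_atMost]] sum.Sigma [OF finite_lessThan ballI [OF finite_atLeastLessThan]]
    by (rule sum.reindex_bij_witness [where i = prod.swap and j = prod.swap]) auto
  also have "\<dots> = (\<Sum>k<N. outer_coeff q p k * tail_coeff q k (N - k))"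
    by (intro sum.cong) (simp_all add: sum_central_term_primitive_root [OF assms(1)] flip: sum_distrib_left)
  also have "\<dots> = outer_coeff q p 0 * tail_coeff q 0 N + (\<Sum>k=1..<N. outer_coeff q p k * tail_coeff q k (N - k))"
    using assms(2) by (simp add: lessThan_atLeast0 sum.atLeast_Suc_lessThan)
  also have "(\<Sum>k=1..<N. outer_coeff q p k * tail_coeff q k (N - k)) = (\<Sum>i\<in>{0..<N - 1}. outer_coeff q p (N - 1 - i) * tail_coeff q (N - 1 - i) (Suc i))"
    by (rule sum.reindex_bij_witness [where i = "\<lambda>i. N - 1 - i" and j = "\<lambda>k. N - 1 - k"])
      (auto simp: Suc_diff_Suc)
  also have "\<dots> = (\<Sum>i\<in>{0..<N - 1}. q ^ p * ((- 1) ^ i * q powi (- int ((i + 1) choose 2) + int p * (int i ^ 2 + 2 * int i)) * alpha_hat q i))"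
    by (intro sum.cong refl outer_coeff_primitive_root [OF assms(1)]) auto
  also have "outer_coeff q p 0 * tail_coeff q 0 N = 1 / 2 * alpha_hat q (N - 1)"
    using tail_coeff_primitive_root [OF assms(1), of 0 "N - 1"] assms(2) by (simp add: outer_coeff_def)
  finally show ?thesis
    using q by (simp add: sum_distrib_left distrib_left power_int_minus)
qed

section \<open>The Bailey chain\<close>

text \<open>
  The sum over \<open>n\<^sub>1, \<dots>, n\<^bsub>p-1\<^esub>\<close> in \<^const>\<open>H2\<close> for \<open>n\<^sub>p = n\<close>. The chain is extended by an index
  \<open>n\<^sub>0 = 0\<close>, so that it starts with the unit Bailey pair.
\<close>

primrec bailey_sum :: "complex \<Rightarrow> nat \<Rightarrow> nat \<Rightarrow> complex" where
  "bailey_sum q 0 n = (if n = 0 then 1 else 0)"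
| "bailey_sum q (Suc p) n = (\<Sum>m\<le>n. q ^ m\<^sup>2 * qbin q n (int m) * bailey_sum q p m)"

text \<open>The alpha sequence of the unit Bailey pair relative to 1.\<close>

definition unit_alpha :: "complex \<Rightarrow> nat \<Rightarrow> complex" where
  "unit_alpha q k = (if k = 0 then 1 else (- 1) ^ k * q ^ (k choose 2) * (1 + q ^ k))"

lemma qbin_even_odd:
  assumes "q \<noteq> 0" "n > 0"
  shows "qbin q (2 * n) (int n - int k)
      = qbin q (2 * n - 1) (int n - int k) + q ^ n * q ^ k * qbin q (2 * n - 1) (int n - int k - 1)"
    and "q ^ k * qbin q (2 * n) (int n - int k)
      = q ^ n * qbin q (2 * n - 1) (int n - int k) + q ^ k * qbin q (2 * n - 1) (int n - int k - 1)"
proof -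
  have n: "2 * n = Suc (2 * n - 1)" "int (2 * n - 1) + 1 - (int n - int k) = int (n + k)"
    using assms(2) by auto
  have "qbin q (Suc (2 * n - 1)) (int n - int k)
      = qbin q (2 * n - 1) (int n - int k) + q ^ n * q ^ k * qbin q (2 * n - 1) (int n - int k - 1)"
    unfolding qbin_Suc' [OF assms(1)] n(2) power_int_of_nat power_add ..
  then show "qbin q (2 * n) (int n - int k)
      = qbin q (2 * n - 1) (int n - int k) + q ^ n * q ^ k * qbin q (2 * n - 1) (int n - int k - 1)"
    using n(1) by simp
  have "qbin q (Suc (2 * n - 1)) (int n - int k)
      = q ^ n / q ^ k * qbin q (2 * n - 1) (int n - int k) + qbin q (2 * n - 1) (int n - int k - 1)"
    unfolding qbin.simps(2) using assms(1) by (simp add: power_int_diff)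
  then show "q ^ k * qbin q (2 * n) (int n - int k)
      = q ^ n * qbin q (2 * n - 1) (int n - int k) + q ^ k * qbin q (2 * n - 1) (int n - int k - 1)"
    using n(1) assms(1) by (simp add: field_simps)
qed

lemma qbin_even_split:
  assumes "q \<noteq> 0" "n > 0"
  shows "(1 + q ^ k) * qbin q (2 * n) (int n - int k)
    = (1 + q ^ n) * (qbin q (2 * n - 1) (int n - int k) + q ^ k * qbin q (2 * n - 1) (int n - int k - 1))"
proof -
  have "(1 + x) * c = (1 + m) * (a + x * b)"
    if "c = a + m * x * b" "x * c = m * a + x * b" for a b c m x :: complex
    using that by algebra
  then show ?thesis using qbin_even_odd [OF assms, of k] by blast
qed

lemma central_term_even:
  assumes "q \<noteq> 0" "n > 0"
  shows "(1 + q ^ n) * central_term q n k = q ^ n * (1 + q ^ k) * qbin q (2 * n) (int n - int k)"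
proof -
  have "(1 + m) * (c - (1 - m) * a) = m * (1 + x) * c"
    if "c = a + m * x * b" "x * c = m * a + x * b" for a b c m x :: complex
    using that by algebra
  then show ?thesis unfolding central_term_def using qbin_even_odd [OF assms, of k] by blast
qed

text \<open>By \<open>qbin_even_split\<close> the partial sums telescope. At \<open>K = n\<close>
  the closed form has a negative lower index and vanishes, which is the unit Bailey pair relation
  for \<open>n > 0\<close>.\<close>

lemma unit_alpha_sum:
  assumes "q \<noteq> 0" "n > 0" "q ^ n \<noteq> 1"
  shows "(\<Sum>k\<le>K. unit_alpha q k * qbin q (2 * n) (int n - int k))
    = (- 1) ^ K * (1 + q ^ n) * q ^ (Suc K choose 2) * qbin q (2 * n - 1) (int n - int K - 1)"
proof (induction K)
  case 0
  have "int (2 * n - 1) + 1 - int n = int n" using assms(2) by simp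
  then have "qbin q (2 * n - 1) (int n) = qbin q (2 * n - 1) (int n - 1)"
    using qbin_ratio [OF assms(1), of "int n" "2 * n - 1"] assms(3) by simp
  moreover have "c = (1 + m) * b" if "(1 + 1) * c = (1 + m) * (a + 1 * b)" "a = b" for a b c m :: complex
    using that by algebra
  ultimately show ?case
    using qbin_even_split [OF assms(1,2), of 0] by (simp add: unit_alpha_def numeral_2_eq_2)
next
  case (Suc K)
  have "unit_alpha q (Suc K) * qbin q (2 * n) (int n - int (Suc K))
    = - ((- 1) ^ K * q ^ (Suc K choose 2) *
      ((1 + q ^ Suc K) * qbin q (2 * n) (int n - int (Suc K))))"
    by (simp add: unit_alpha_def)
  also have "\<dots> = - ((- 1) ^ K * q ^ (Suc K choose 2) * ((1 + q ^ n) *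
       (qbin q (2 * n - 1) (int n - int K - 1) + q ^ Suc K * qbin q (2 * n - 1) (int n - int (Suc K) - 1))))"
    unfolding qbin_even_split [OF assms(1,2)] by (simp add: algebra_simps)
  finally have u: "unit_alpha q (Suc K) * qbin q (2 * n) (int n - int (Suc K)) = \<dots>" .
  have "Suc (Suc K) choose 2 = (Suc K choose 2) + Suc K"
    by (simp add: numeral_2_eq_2)
  then show ?case
    unfolding sum.atMost_Suc Suc.IH u by (simp add: power_add algebra_simps)
qed

lemma qpoch_nonzero:
  assumes "\<And>m. 0 < m \<Longrightarrow> m \<le> n \<Longrightarrow> q ^ m \<noteq> 1"
  shows "qpoch q q n \<noteq> 0"
  using assms by (induction n) (auto simp: qpoch_self_Suc simp del: power_Suc)

lemma qbin_eq_qpoch: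
  assumes "q \<noteq> 0" "k \<le> n" "qpoch q q n \<noteq> 0"
  shows "qbin q n (int k) = qpoch q q n / (qpoch q q (n - k) * qpoch q q k)"
proof -
  have "qpoch q q k \<noteq> 0" "qpoch q q (n - k) \<noteq> 0"
    using qbin_mult_qpoch [OF assms(1,2)] assms(3) by auto
  then show ?thesis
    using qbin_mult_qpoch [OF assms(1,2)] by (simp add: field_simps)
qed

section \<open>Bailey's lemma when q is nonzero and not a root of unity\<close>

context
  fixes q :: complex
  assumes nonzero: "q \<noteq> 0" and generic: "\<And>n. n > 0 \<Longrightarrow> q ^ n \<noteq> 1"
begin

lemma qpoch_generic: "qpoch q q n \<noteq> 0"
  by (rule qpoch_nonzero) (use generic in auto)

text \<open>A limiting q-Vandermonde sum. After shifting \<open>j\<close>, the second Pascal term is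
  the same sum with \<open>Suc a\<close> in place of \<open>a\<close>, so \<open>a\<close> must be
  arbitrary in the induction.\<close>

lemma q_vandermonde:
  "(\<Sum>j\<le>M. q ^ (j * (j + a)) * qbin q M (int j) / qpoch q q (j + a)) = 1 / qpoch q q (M + a)"
proof (induction M arbitrary: a)
  case 0
  then show ?case by simp
next
  case (Suc M)
  have "(\<Sum>j\<le>Suc M. q ^ (j * (j + a)) * qbin q (Suc M) (int j) / qpoch q q (j + a))
      = (\<Sum>j\<le>Suc M. q ^ (j * (j + a)) * qbin q M (int j) / qpoch q q (j + a))
        + (\<Sum>j\<le>Suc M. q ^ (j * (j + a)) * q powi (int M + 1 - int j) * qbin q M (int j - 1) / qpoch q q (j + a))"
    unfolding qbin_Suc' [OF nonzero] by (simp only: sum.distrib [symmetric]) (simp add: add_divide_distrib distrib_left mult.assoc)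
  also have "(\<Sum>j\<le>Suc M. q ^ (j * (j + a)) * qbin q M (int j) / qpoch q q (j + a)) = 1 / qpoch q q (M + a)"
    using Suc.IH [of a] by (simp add: qbin_eq_0)
  also have "(\<Sum>j\<le>Suc M. q ^ (j * (j + a)) * q powi (int M + 1 - int j) * qbin q M (int j - 1) / qpoch q q (j + a))
      = (\<Sum>j\<le>M. q ^ Suc (M + a) * (q ^ (j * (j + Suc a)) * qbin q M (int j) / qpoch q q (j + Suc a)))"
    unfolding sum.atMost_Suc_shift
  proof -
    have "q ^ (Suc j * (Suc j + a)) * q powi (int M + 1 - int (Suc j)) = q ^ Suc (M + a) * q ^ (j * (j + Suc a))"
      if "j \<le> M" for j
    proof -
      have "int M + 1 - int (Suc j) = int (M - j)" using that by simp
      moreover have "Suc j * (Suc j + a) + (M - j) = Suc (M + a) + j * (j + Suc a)"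
        using that by (simp add: algebra_simps)
      ultimately show ?thesis by (metis power_add power_int_of_nat)
    qed
    then show "q ^ (0 * (0 + a)) * q powi (int M + 1 - int 0) * qbin q M (int 0 - 1) / qpoch q q (0 + a)
      + (\<Sum>j\<le>M. q ^ (Suc j * (Suc j + a)) * q powi (int M + 1 - int (Suc j)) * qbin q M (int (Suc j) - 1) / qpoch q q (Suc j + a))
      = (\<Sum>j\<le>M. q ^ Suc (M + a) * (q ^ (j * (j + Suc a)) * qbin q M (int j) / qpoch q q (j + Suc a)))"
      by (auto simp: qbin_eq_0 mult.assoc intro!: sum.cong)
  qed
  also have "\<dots> = q ^ Suc (M + a) / qpoch q q (Suc (M + a))"
    unfolding sum_distrib_left [symmetric] Suc.IH by simp
  also have "1 / qpoch q q (M + a) + q ^ Suc (M + a) / qpoch q q (Suc (M + a)) = 1 / qpoch q q (Suc M + a)"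
    using qpoch_generic [of "M + a"] qpoch_generic [of "Suc (M + a)"]
    by (simp add: qpoch_self_Suc field_simps)
  finally show ?case .
qed

text \<open>With \<open>m = j + k\<close> this is \<open>q_vandermonde\<close> for
  \<open>M = n - k\<close> and \<open>a = 2 * k\<close>. It is the inner sum in one step of the
  Bailey chain.\<close>

lemma bailey_kernel:
  assumes "k \<le> n"
  shows "(\<Sum>m=k..n. q ^ m\<^sup>2 / (qpoch q q (n - m) * qpoch q q (m - k) * qpoch q q (m + k)))
    = q ^ k\<^sup>2 / (qpoch q q (n - k) * qpoch q q (n + k))"
proof -
  define M where "M = n - k"
  have n: "n = M + k" using assms by (simp add: M_def)
  have "(\<Sum>m=k..n. q ^ m\<^sup>2 / (qpoch q q (n - m) * qpoch q q (m - k) * qpoch q q (m + k)))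
      = (\<Sum>j\<le>M. q ^ (j + k)\<^sup>2 / (qpoch q q (M - j) * qpoch q q j * qpoch q q (j + 2 * k)))"
    unfolding n by (rule sum.reindex_bij_witness [where i = "\<lambda>j. j + k" and j = "\<lambda>m. m - k"]) (auto simp: mult_2)
  also have "\<dots> = (\<Sum>j\<le>M. q ^ k\<^sup>2 / qpoch q q M * (q ^ (j * (j + 2 * k)) * qbin q M (int j) / qpoch q q (j + 2 * k)))"
  proof (rule sum.cong)
    fix j assume "j \<in> {..M}"
    then have "qbin q M (int j) = qpoch q q M / (qpoch q q (M - j) * qpoch q q j)"
      by (intro qbin_eq_qpoch nonzero qpoch_generic) simp
    moreover have "(j + k)\<^sup>2 = k\<^sup>2 + j * (j + 2 * k)"
      by (simp add: power2_eq_square algebra_simps)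
    then have "q ^ (j + k)\<^sup>2 = q ^ k\<^sup>2 * q ^ (j * (j + 2 * k))"
      by (simp only: power_add)
    ultimately show "q ^ (j + k)\<^sup>2 / (qpoch q q (M - j) * qpoch q q j * qpoch q q (j + 2 * k))
       = q ^ k\<^sup>2 / qpoch q q M * (q ^ (j * (j + 2 * k)) * qbin q M (int j) / qpoch q q (j + 2 * k))"
      using qpoch_generic by (simp add: field_simps)
  qed simp
  also have "\<dots> = q ^ k\<^sup>2 / (qpoch q q M * qpoch q q (M + 2 * k))"
    unfolding sum_distrib_left [symmetric] q_vandermonde by simp
  finally show ?thesis by (simp add: n mult_2 add.assoc)
qed

lemma bailey_pair:
  "bailey_sum q p n / qpoch q q n
    = (\<Sum>k\<le>n. unit_alpha q k * q ^ (p * k\<^sup>2) / (qpoch q q (n - k) * qpoch q q (n + k)))"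
proof (induction p arbitrary: n)
  case 0
  show ?case
  proof (cases "n = 0")
    case True
    then show ?thesis by (simp add: unit_alpha_def)
  next
    case False
    have "unit_alpha q k * q ^ (0 * k\<^sup>2) / (qpoch q q (n - k) * qpoch q q (n + k))
        = unit_alpha q k * qbin q (2 * n) (int n - int k) / qpoch q q (2 * n)" if "k \<le> n" for k
      using that qbin_eq_qpoch [OF nonzero _ qpoch_generic, of "n - k" "2 * n"] qpoch_generic
      by (simp add: of_nat_diff mult.commute)
    then have "(\<Sum>k\<le>n. unit_alpha q k * q ^ (0 * k\<^sup>2) / (qpoch q q (n - k) * qpoch q q (n + k)))
        = (\<Sum>k\<le>n. unit_alpha q k * qbin q (2 * n) (int n - int k)) / qpoch q q (2 * n)"
      by (simp add: sum_divide_distrib)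
    also have "\<dots> = 0"
      using False generic [of n] by (simp add: unit_alpha_sum [OF nonzero] qbin_eq_0)
    finally show ?thesis using False by simp
  qed
next
  case (Suc p)
  let ?t = "\<lambda>m k. unit_alpha q k * q ^ (p * k\<^sup>2) *
    (q ^ m\<^sup>2 / (qpoch q q (n - m) * qpoch q q (m - k) * qpoch q q (m + k)))"
  have "bailey_sum q (Suc p) n / qpoch q q n
      = (\<Sum>m\<le>n. q ^ m\<^sup>2 / qpoch q q (n - m) * (bailey_sum q p m / qpoch q q m))"
    unfolding bailey_sum.simps sum_divide_distrib
    by (intro sum.cong refl) (simp add: qbin_eq_qpoch [OF nonzero _ qpoch_generic] qpoch_generic)
  also have "\<dots> = (\<Sum>m\<le>n. \<Sum>k\<le>m. ?t m k)"
    unfolding Suc.IH sum_distrib_left by (intro sum.cong refl) (simp add: mult_ac)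
  also have "\<dots> = (\<Sum>k\<le>n. \<Sum>m=k..n. ?t m k)"
    unfolding sum.Sigma [OF finite_atMost ballI [OF finite_atMost]]
      sum.Sigma [OF finite_atMost ballI [OF finite_atLeastAtMost]]
    by (rule sum.reindex_bij_witness [where i = prod.swap and j = prod.swap]) auto
  also have "\<dots> = (\<Sum>k\<le>n. unit_alpha q k * q ^ (Suc p * k\<^sup>2) / (qpoch q q (n - k) * qpoch q q (n + k)))"
    unfolding sum_distrib_left [symmetric]
    by (intro sum.cong refl) (simp add: bailey_kernel power_add)
  finally show ?case .
qed

lemma H2_summand_generic:
  assumes "n > 0"
  shows "q ^ n * qpoch (q ^ n) q n * bailey_sum q p n = (\<Sum>k\<le>n. outer_coeff q p k * central_term q n k)"
proof -
  have "q ^ (2 * n) \<noteq> 1" using generic [of "2 * n"] assms by simp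
  then have "1 + q ^ n \<noteq> 0"
    by (metis add_eq_0_iff mult_minus1 mult_2 power_add minus_mult_minus mult_1)
  obtain m where m: "n = Suc m" using assms gr0_conv_Suc by blast
  have "qpoch q q (2 * n) = qpoch q q m * qpoch (q ^ n) q n * (1 - q ^ (2 * n))"
    using qpoch_power_mult [of q m n] qpoch_self_Suc [of q "m + n"] by (simp add: m mult_2)
  \<comment> \<open>This turns the prefactor in \<open>H2\<close> into
    \<open>qpoch q q (2 * n)\<close>, which completes the Bailey denominators to Gaussian
    coefficients.\<close>
  then have e: "(1 + q ^ n) * qpoch (q ^ n) q n * qpoch q q n = qpoch q q (2 * n)"
    unfolding m qpoch_self_Suc mult_2 power_add by (simp add: algebra_simps)
  have "(1 + q ^ n) * (q ^ n * qpoch (q ^ n) q n * bailey_sum q p n)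
      = q ^ n * (qpoch q q (2 * n) * (bailey_sum q p n / qpoch q q n))"
    unfolding e [symmetric] using qpoch_generic [of n] by simp
  also have "\<dots> = (\<Sum>k\<le>n. (1 + q ^ n) * (outer_coeff q p k * central_term q n k))"
    unfolding bailey_pair sum_distrib_left
  proof (rule sum.cong)
    fix k assume "k \<in> {..n}"
    then have "qbin q (2 * n) (int n - int k) = qpoch q q (2 * n) / (qpoch q q (n - k) * qpoch q q (n + k))"
      using qbin_eq_qpoch [OF nonzero _ qpoch_generic, of "n - k" "2 * n"]
      by (simp add: of_nat_diff mult.commute)
    then have "q ^ n * (qpoch q q (2 * n) * (unit_alpha q k * q ^ (p * k\<^sup>2) / (qpoch q q (n - k) * qpoch q q (n + k))))
       = q ^ n * (unit_alpha q k * q ^ (p * k\<^sup>2)) * qbin q (2 * n) (int n - int k)"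
      by simp
    also have "\<dots> = outer_coeff q p k * (q ^ n * (1 + q ^ k) * qbin q (2 * n) (int n - int k))"
      by (simp add: outer_coeff_def unit_alpha_def power_add)
    also have "\<dots> = (1 + q ^ n) * (outer_coeff q p k * central_term q n k)"
      unfolding central_term_even [OF nonzero assms, symmetric] by (simp only: mult_ac)
    finally show "q ^ n * (qpoch q q (2 * n) * (unit_alpha q k * q ^ (p * k\<^sup>2) / (qpoch q q (n - k) * qpoch q q (n + k))))
       = (1 + q ^ n) * (outer_coeff q p k * central_term q n k)" .
  qed simp
  finally show ?thesis
    using \<open>1 + q ^ n \<noteq> 0\<close> by (simp add: sum_distrib_left [symmetric])
qed

end

section \<open>Passage to roots of unity by continuity\<close>

lemma tendsto_qbin [tendsto_intros]:
  assumes "(f \<longlongrightarrow> q) F" "q \<noteq> 0"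
  shows "((\<lambda>x. qbin (f x) n i) \<longlongrightarrow> qbin q n i) F"
  using assms by (induction n arbitrary: i) (auto simp: qbin.simps(2) intro!: tendsto_intros)

lemma tendsto_bailey_sum [tendsto_intros]:
  assumes "(f \<longlongrightarrow> q) F" "q \<noteq> 0"
  shows "((\<lambda>x. bailey_sum (f x) p n) \<longlongrightarrow> bailey_sum q p n) F"
  using assms by (induction p arbitrary: n) (auto intro!: tendsto_intros)

text \<open>
  At a root of unity the Bailey pair has zero denominators, but both sides below are continuous in \<open>q\<close>,
  so the identity is carried over from the open unit disc.
\<close>

lemma H2_summand:
  assumes "norm q = 1" "n > 0"
  shows "q ^ n * qpoch (q ^ n) q n * bailey_sum q p n = (\<Sum>k\<le>n. outer_coeff q p k * central_term q n k)"
proof -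
  \<comment> \<open>A radial approach to \<open>q\<close> with moduli strictly between 0 and 1; the
    double \<open>Suc\<close> avoids 0 at \<open>i = 0\<close>.\<close>
  define x where "x i = complex_of_real (1 - inverse (real (Suc (Suc i)))) * q" for i
  have q: "q \<noteq> 0" using assms by auto
  have "(\<lambda>i. 1 - inverse (real (Suc (Suc i)))) \<longlonglongrightarrow> 1 - 0"
    using LIMSEQ_Suc [OF LIMSEQ_inverse_real_of_nat] by (intro tendsto_intros)
  then have "x \<longlonglongrightarrow> complex_of_real 1 * q"
    unfolding x_def by (intro tendsto_intros) simp
  then have lim: "x \<longlonglongrightarrow> q" by simp
  have eq: "x i ^ n * qpoch (x i ^ n) (x i) n * bailey_sum (x i) p n
      = (\<Sum>k\<le>n. outer_coeff (x i) p k * central_term (x i) n k)" for i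
  proof (rule H2_summand_generic)
    have b: "0 < 1 - inverse (real (Suc (Suc i)))" "1 - inverse (real (Suc (Suc i))) < 1"
      by (simp_all add: field_simps)
    then have norm: "norm (x i) = 1 - inverse (real (Suc (Suc i)))"
      unfolding x_def norm_mult norm_of_real using assms(1) by simp
    show "x i \<noteq> 0" using norm b by auto
    show "x i ^ m \<noteq> 1" if "m > 0" for m
    proof
      assume "x i ^ m = 1"
      then have "norm (x i) ^ m = 1" by (metis norm_one norm_power)
      moreover have "norm (x i) ^ m < 1"
        using power_Suc_less_one [of "norm (x i)" "m - 1"] norm b that by simp
      ultimately show False by simp
    qed
  qed (rule assms(2))
  have "(\<lambda>i. x i ^ n * qpoch (x i ^ n) (x i) n * bailey_sum (x i) p n)
      \<longlonglongrightarrow> q ^ n * qpoch (q ^ n) q n * bailey_sum q p n"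
    unfolding qpoch_def by (intro tendsto_intros lim q)
  moreover have "(\<lambda>i. outer_coeff (x i) p k) \<longlonglongrightarrow> outer_coeff q p k" for k
    unfolding outer_coeff_def by (auto intro!: tendsto_intros lim)
  then have "(\<lambda>i. \<Sum>k\<le>n. outer_coeff (x i) p k * central_term (x i) n k) \<longlonglongrightarrow> (\<Sum>k\<le>n. outer_coeff q p k * central_term q n k)"
    unfolding central_term_def by (intro tendsto_intros lim q)
  ultimately show ?thesis
    unfolding eq by (rule LIMSEQ_unique)
qed

section \<open>The multiple sum as an iterated sum\<close>

lemma qpoch_power_eq_0:
  assumes "q ^ N = 1" "N \<ge> 1" "N \<le> n"
  shows "qpoch (q ^ n) q n = 0"
proof -
  \<comment> \<open>The least multiple of \<open>N\<close> that is at least \<open>n\<close>. It is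
    below \<open>2 * n\<close>, so factor number \<open>c - n + 1\<close> of the product
    vanishes.\<close>
  define c where "c = (n + N - 1) div N * N"
  have "c + (n + N - 1) mod N = n + N - 1" unfolding c_def by (rule div_mult_mod_eq)
  moreover have "(n + N - 1) mod N < N" using assms(2) by simp
  ultimately have c: "n \<le> c" "c < n + N" by linarith+
  have "q ^ n * q ^ (Suc (c - n) - 1) = (q ^ N) ^ (c div N)"
    using c assms(2) by (simp add: c_def flip: power_add power_mult) (simp add: mult.commute)
  then have "1 - q ^ n * q ^ (Suc (c - n) - 1) = 0" using assms(1) by simp
  moreover have "Suc (c - n) \<in> {1..n}" using c assms(3) by auto
  ultimately show ?thesis unfolding qpoch_def by (meson finite_atLeastAtMost prod_zero)
qed

definition chains :: "nat \<Rightarrow> nat \<Rightarrow> (nat \<Rightarrow> nat) set" where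
  "chains p n = {f \<in> {1..p} \<rightarrow>\<^sub>E UNIV. mono_on {1..p} f \<and> f p = n}"

lemma finite_chains: "finite (chains p n)"
proof (rule finite_subset)
  show "chains p n \<subseteq> {1..p} \<rightarrow>\<^sub>E {..n}"
  proof
    fix f assume f: "f \<in> chains p n"
    then have mono: "mono_on {1..p} f" by (simp add: chains_def)
    have "f i \<le> n" if "i \<in> {1..p}" for i
      using mono_onD [OF mono that, of p] that f by (auto simp: chains_def)
    then show "f \<in> {1..p} \<rightarrow>\<^sub>E {..n}"
      using f by (auto simp: chains_def PiE_def)
  qed
qed (simp add: finite_PiE)

text \<open>Remove the top index and induct on \<open>p\<close>. The bound \<open>n < N\<close>
  keeps the denominators in \<open>qbinom\<close> nonzero, so \<open>qbinom\<close> agrees with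
  \<open>qbin\<close>.\<close>

lemma chain_sum:
  assumes "p \<ge> 1" "n < N" "\<And>m. m < N \<Longrightarrow> qpoch q q m \<noteq> 0" "q \<noteq> 0"
  shows "(\<Sum>f\<in>chains p n. \<Prod>i=1..<p. q ^ (f i)\<^sup>2 * qbinom q (f (i + 1)) (f i)) = bailey_sum q p n"
  using assms(1,2)
proof (induction p arbitrary: n rule: nat_induct_at_least)
  case base
  have "chains 1 n = {\<lambda>i\<in>{1}. n}"
  proof
    show "chains 1 n \<subseteq> {\<lambda>i\<in>{1}. n}"
    proof
      fix f assume "f \<in> chains 1 n"
      then have "f \<in> extensional {1}" "f 1 = n" by (auto simp: chains_def PiE_def)
      then have "f = (\<lambda>i\<in>{1}. n)" by (intro extensionalityI [of f "{1}"]) auto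
      then show "f \<in> {\<lambda>i\<in>{1}. n}" by simp
    qed
  qed (auto simp: chains_def intro!: mono_onI)
  \<comment> \<open>The added index \<open>n_0 = 0\<close> contributes 1, matching the empty product
    for \<open>p = 1\<close>.\<close>
  moreover have "(\<Sum>m\<le>n. q ^ m\<^sup>2 * qbin q n (int m) * (if m = 0 then 1 else 0)) = 1"
    by (simp add: if_distrib [of "\<lambda>x. _ * x"] sum.delta cong: if_cong)
  ultimately show ?case by (simp add: numeral_eq_Suc)
next
  case (Suc p)
  let ?P = "\<lambda>p f. \<Prod>i=1..<p. q ^ (f i)\<^sup>2 * qbinom q (f (i + 1)) (f i)"
  have "(\<Sum>f\<in>chains (Suc p) n. ?P (Suc p) f)
     = (\<Sum>(m, f)\<in>(SIGMA m:{..n}. chains p m). q ^ m\<^sup>2 * qbin q n (int m) * ?P p f)"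
  proof (rule sum.reindex_bij_witness [where j = "\<lambda>f. (f p, restrict f {1..p})" and i = "\<lambda>(m, f). f(Suc p := n)"])
    fix f assume f: "f \<in> chains (Suc p) n"
    then have m: "mono_on {1..Suc p} f" and ext: "f \<in> extensional {1..Suc p}" and n: "f (Suc p) = n"
      by (auto simp: chains_def PiE_def)
    have le: "f p \<le> n" using mono_onD [OF m, of p "Suc p"] n Suc.hyps by simp
    show "(f p, restrict f {1..p}) \<in> (SIGMA m:{..n}. chains p m)"
      using le Suc.hyps by (auto simp: chains_def intro!: mono_onI mono_onD [OF m])
    show "(case (f p, restrict f {1..p}) of (m, f) \<Rightarrow> f(Suc p := n)) = f"
      using n ext by (auto simp: fun_eq_iff restrict_def extensional_def le_Suc_eq)
    have "qbin q n (int (f p)) = qbinom q n (f p)"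
      unfolding qbinom_def by (rule qbin_eq_qpoch) (use le assms Suc.prems in auto)
    moreover have "?P p (restrict f {1..p}) = ?P p f"
      by (intro prod.cong) auto
    ultimately show "(case (f p, restrict f {1..p}) of (m, f) \<Rightarrow> q ^ m\<^sup>2 * qbin q n (int m) * ?P p f) = ?P (Suc p) f"
      using Suc.hyps n by (simp add: prod.atLeastLessThan_Suc mult.commute)
  next
    fix a assume "a \<in> (SIGMA m:{..n}. chains p m)"
    then obtain m f where a: "a = (m, f)" and "m \<le> n" and f: "f \<in> chains p m" by auto
    have mono: "mono_on {1..p} f" and ext: "f \<in> extensional {1..p}" and m: "f p = m"
      using f by (auto simp: chains_def PiE_def)
    show "(\<lambda>f. (f p, restrict f {1..p})) (case a of (m, f) \<Rightarrow> f(Suc p := n)) = a"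
      using ext m by (auto simp: a fun_eq_iff restrict_def extensional_def)
    have "f i \<le> n" if "i \<in> {1..p}" for i
      using mono_onD [OF mono that, of p] that m \<open>m \<le> n\<close> by auto
    then show "(case a of (m, f) \<Rightarrow> f(Suc p := n)) \<in> chains (Suc p) n"
      using ext mono by (auto simp: a chains_def extensional_def PiE_def intro!: mono_onI mono_onD [OF mono])
  qed
  also have "\<dots> = (\<Sum>m\<le>n. \<Sum>f\<in>chains p m. q ^ m\<^sup>2 * qbin q n (int m) * ?P p f)"
    by (rule sum.Sigma [symmetric]) (auto simp: finite_chains)
  also have "\<dots> = bailey_sum q (Suc p) n"
    using Suc by (simp flip: sum_distrib_left)
  finally show ?case .
qed

lemma H2_eq_finite_sum:
  assumes "primitive_root_of_unity N q" "p \<ge> 1"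
  shows "H2 p q = (\<Sum>n<N. q ^ n * qpoch (q ^ n) q n * bailey_sum q p n)"
proof -
  have q: "q \<noteq> 0" "q ^ N = 1" "N \<ge> 1"
    using assms(1) primitive_root_nonzero [OF assms(1)] by (simp_all add: primitive_root_of_unity_def)
  have poch: "qpoch q q m \<noteq> 0" if "m < N" for m
    using assms(1) that by (intro qpoch_nonzero) (auto simp: primitive_root_of_unity_def)
  let ?P = "\<lambda>f. \<Prod>i=1..<p. q ^ (f i)\<^sup>2 * qbinom q (f (i + 1)) (f i)"
  let ?S = "\<Union>n<N. chains p n"
  have "H2 p q = (\<Sum>\<^sub>\<infinity>f\<in>?S. q ^ f p * qpoch (q ^ f p) q (f p) * ?P f)"
    unfolding H2_def
    by (rule infsum_cong_neutral) (auto simp: chains_def qpoch_power_eq_0 [OF q(2,3)] not_less)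
  also have "\<dots> = (\<Sum>f\<in>?S. q ^ f p * qpoch (q ^ f p) q (f p) * ?P f)"
    by (rule infsum_finite) (simp add: finite_chains)
  also have "\<dots> = (\<Sum>n<N. \<Sum>f\<in>chains p n. q ^ f p * qpoch (q ^ f p) q (f p) * ?P f)"
    by (rule sum.UNION_disjoint) (auto simp: finite_chains, auto simp: chains_def)
  also have "\<dots> = (\<Sum>n<N. q ^ n * qpoch (q ^ n) q n * (\<Sum>f\<in>chains p n. ?P f))"
    unfolding sum_distrib_left by (intro sum.cong refl) (auto simp: chains_def)
  also have "\<dots> = (\<Sum>n<N. q ^ n * qpoch (q ^ n) q n * bailey_sum q p n)"
    using chain_sum [OF assms(2) _ poch q(1)] by (intro sum.cong refl) simp
  finally show ?thesis .
qed

theorem theorem2p15: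
  fixes p N :: nat and q :: complex
  assumes "p \<ge> 1" and "N \<ge> 1" and "primitive_root_of_unity N q"
  shows "- (1 / 2) + H2 p q =
    q ^ p * ((\<Sum>k\<in>{0..<N - 1}. (- 1) ^ k
                 * q powi (- int ((k + 1) choose 2) + int p * (int k ^ 2 + 2 * int k))
                 * alpha_hat q k)
             + 1 / 2 * q powi (- int p) * alpha_hat q (N - 1))"
proof -
  have "norm q ^ N = 1"
    using assms(3) by (simp add: primitive_root_of_unity_def flip: norm_power)
  then have norm: "norm q = 1"
    using assms(2) power_eq_1_iff by fastforce
  have zero: "bailey_sum q p 0 = 1"
    by (induction p) simp_all
  \<comment> \<open>The case \<open>n = 0\<close>, excluded from \<open>H2_summand\<close>: the
    summand is 1 and the right-hand side \<open>1 / 2\<close>, which accounts for the constant in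
    the theorem.\<close>
  have "- (1 / 2) + q ^ n * qpoch (q ^ n) q n * bailey_sum q p n
     = (\<Sum>k\<le>n. outer_coeff q p k * central_term q n k)" if "n = 0" for n
    using that zero by (simp add: outer_coeff_def central_term_def)
  then have "- (1 / 2) + (\<Sum>n<N. q ^ n * qpoch (q ^ n) q n * bailey_sum q p n)
      = (\<Sum>n<N. \<Sum>k\<le>n. outer_coeff q p k * central_term q n k)"
    using assms(2) by (simp add: lessThan_atLeast0 sum.atLeast_Suc_lessThan H2_summand [OF norm])
  then show ?thesis
    unfolding H2_eq_finite_sum [OF assms(3,1)] sum_central_term_eq_alpha_hat [OF assms(3,2)] .
qed

end
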